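(* Let $m>1$ and let $x_0=0$ be a nonhyperbolic singularity of the one-dimensional system $$\dot x=f^{(m)}(x)+\mathcal{O}(|x|^{m+1}),\qquad x\in\mathbb{R},$$ and let $\phi_1(x)$ be the associated unit-time map. Then there exists $r_1>0$ such that for the sequence $S(x_1)=(x_n)_{n\ge1}$ with $x_1\in(0,r_1)$, defined by $$x_{n+1}=\begin{cases}\phi_1(x_n), & \text{if } x_0 \text{ is stable},\\ \phi_1^{-1}(x_n), & \text{if } x_0\text{ is unstable},\end{cases}$$ we have $$\dim_BS(x_1)=1-\frac1m.$$
   Context: Here $f^{(m)}(x)$ denotes the term of degree $m$ with which the Taylor expansion of the (sufficiently smooth) right-hand side at $0$ begins; it is not an $m$-th derivative. A singularity is a zero of the right-hand side; it is nonhyperbolic if the derivative of the right-hand side vanishes there. The unit-time map $\phi_1$ is the time-$1$ map of the flow of the system (near $0$). A sequence is identified with its set of points. Box dimension: for a bounded set $A\subset\mathbb{R}^N$ let $A_\varepsilon=\{y\in\mathbb{R}^N: d(y,A)<\varepsilon\}$ and let $|A_\varepsilon|$ be its Lebesgue measure. For $s\ge 0$ put $\mathcal{M}_*^s(A)=\liminf_{\varepsilon\to0}|A_\varepsilon|/\varepsilon^{N-s}$ and $\mathcal{M}^{*s}(A)=\limsup_{\varepsilon\to0}|A_\varepsilon|/\varepsilon^{N-s}$. The lower and upper box dimensions are $\underline{\dim}_B A=\inf\{s>0:\mathcal{M}_*^s(A)=0\}$ and $\overline{\dim}_B A=\inf\{s>0:\mathcal{M}^{*s}(A)=0\}$; if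 they coincide, the common value is denoted $\dim_B A$.
   Formalization: "Stable" is taken as stable with respect to initial values to the right of 0: with two-sided stability the claim fails for even m and negative leading coefficient (e.g. -x^2), where iterates of the inverse map move away from 0 and become undefined; in all other cases the two notions agree. *)

theory Defs
  imports "HOL-Analysis.Analysis" "HOL-Library.Landau_Symbols"
begin

definition parallel_body :: "'a::metric_space set \<Rightarrow> real \<Rightarrow> 'a set" where
  "parallel_body A \<epsilon> = {y. \<exists>a\<in>A. dist y a < \<epsilon>}"

text \<open>
  For nonempty \<open>A\<close> this is the set of \<open>y\<close> with \<open>infdist y A < \<epsilon>\<close>. The contents are
  \<open>ennreal\<close>-valued and the dimensions \<open>ereal\<close>-valued, so that no finiteness or boundedness
  is needed for the limits and infima to have their usual meaning.
\<close>

definition lower_content :: "real \<Rightarrow> 'a::euclidean_space set \<Rightarrow> ennreal" where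
  "lower_content s A =
     Liminf (at_right 0)
       (\<lambda>\<epsilon>. emeasure lebesgue (parallel_body A \<epsilon>) / ennreal (\<epsilon> powr (real DIM('a) - s)))"

definition upper_content :: "real \<Rightarrow> 'a::euclidean_space set \<Rightarrow> ennreal" where
  "upper_content s A =
     Limsup (at_right 0)
       (\<lambda>\<epsilon>. emeasure lebesgue (parallel_body A \<epsilon>) / ennreal (\<epsilon> powr (real DIM('a) - s)))"

definition lower_box_dim :: "'a::euclidean_space set \<Rightarrow> ereal" where
  "lower_box_dim A = Inf (ereal ` {s. 0 < s \<and> lower_content s A = 0})"

definition upper_box_dim :: "'a::euclidean_space set \<Rightarrow> ereal" where
  "upper_box_dim A = Inf (ereal ` {s. 0 < s \<and> upper_content s A = 0})"

definition has_box_dim :: "'a::euclidean_space set \<Rightarrow> real \<Rightarrow> bool" where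
  "has_box_dim A d \<longleftrightarrow> bounded A \<and> lower_box_dim A = ereal d \<and> upper_box_dim A = ereal d"

text \<open>\<open>C\<^sup>k\<close> on an open set of reals.\<close>

definition C_on :: "nat \<Rightarrow> real set \<Rightarrow> (real \<Rightarrow> real) \<Rightarrow> bool" where
  "C_on k U f \<longleftrightarrow>
     (\<forall>j<k. \<forall>x\<in>U. (deriv ^^ j) f field_differentiable (at x)) \<and>
     continuous_on U ((deriv ^^ k) f)"

definition taylor_coeff :: "(real \<Rightarrow> real) \<Rightarrow> nat \<Rightarrow> real" where
  "taylor_coeff f k = (deriv ^^ k) f 0 / fact k"

text \<open>\<open>f\<close> has the form \<open>c x\<^sup>m + O(\<bar>x\<bar>\<^sup>m\<^sup>+\<^sup>1)\<close> at \<open>0\<close>, where \<open>c x\<^sup>m\<close> with \<open>c \<noteq> 0\<close> is the first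
  nonvanishing Taylor term.\<close>

definition taylor_begins_with_degree :: "(real \<Rightarrow> real) \<Rightarrow> nat \<Rightarrow> bool" where
  "taylor_begins_with_degree f m \<longleftrightarrow>
     (\<forall>k<m. taylor_coeff f k = 0) \<and> taylor_coeff f m \<noteq> 0 \<and>
     (\<lambda>x. f x - taylor_coeff f m * x ^ m) \<in> O[at 0](\<lambda>x. \<bar>x\<bar> ^ (m + 1))"

definition nonhyperbolic_singularity :: "(real \<Rightarrow> real) \<Rightarrow> real \<Rightarrow> bool" where
  "nonhyperbolic_singularity f x0 \<longleftrightarrow> f x0 = 0 \<and> (f has_real_derivative 0) (at x0)"

definition ode_solution :: "(real \<Rightarrow> real) \<Rightarrow> real set \<Rightarrow> real set \<Rightarrow> (real \<Rightarrow> real) \<Rightarrow> bool" where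
  "ode_solution f U T u \<longleftrightarrow>
     (\<forall>t\<in>T. u t \<in> U \<and> (u has_real_derivative f (u t)) (at t within T))"

definition flow_domain :: "(real \<Rightarrow> real) \<Rightarrow> real set \<Rightarrow> real \<Rightarrow> real set" where
  "flow_domain f U t = {x. \<exists>u. ode_solution f U (closed_segment 0 t) u \<and> u 0 = x}"

text \<open>Meaningful for \<open>x \<in> flow_domain f U t\<close> when solutions are unique, e.g. for \<open>f\<close> of class
  \<open>C\<^sup>1\<close> on the open set \<open>U\<close>.\<close>

definition flow_map :: "(real \<Rightarrow> real) \<Rightarrow> real set \<Rightarrow> real \<Rightarrow> real \<Rightarrow> real" where
  "flow_map f U t x = (THE y. \<exists>u. ode_solution f U (closed_segment 0 t) u \<and> u 0 = x \<and> u t = y)"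

definition unit_time_map :: "(real \<Rightarrow> real) \<Rightarrow> real set \<Rightarrow> real \<Rightarrow> real" where
  "unit_time_map f U = flow_map f U 1"

definition unit_time_map_inv :: "(real \<Rightarrow> real) \<Rightarrow> real set \<Rightarrow> real \<Rightarrow> real" where
  "unit_time_map_inv f U = inv_into (flow_domain f U 1) (unit_time_map f U)"

text \<open>
  Lyapunov stability with respect to initial values on the right of \<open>x0\<close>. The one-sided notion
  is the relevant one for orbits in \<open>x > x0\<close>: if \<open>f\<close> has even order at \<open>x0\<close>, then \<open>x0\<close> is
  attracting from one side and repelling from the other. For odd order it agrees with
  two-sided stability.
\<close>

definition stable_from_right :: "(real \<Rightarrow> real) \<Rightarrow> real set \<Rightarrow> real \<Rightarrow> bool" where
  "stable_from_right f U x0 \<longleftrightarrow>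
     (\<forall>\<epsilon>>0. \<exists>\<delta>>0. \<forall>x\<in>{x0..<x0 + \<delta>}.
        \<exists>u. ode_solution f U {0..} u \<and> u 0 = x \<and> (\<forall>t\<ge>0. \<bar>u t - x0\<bar> < \<epsilon>))"

end

theory Submission
  imports Defs
begin

text \<open>
  Near \<open>0\<close> the speed \<open>\<bar>f x\<bar>\<close> lies between two multiples of \<open>x\<^sup>m\<close>. Let \<open>F\<close> be an antiderivative of
  \<open>- 1 / \<bar>f\<bar>\<close> on \<open>(0, r)\<close>, i.e. the time of arrival at \<open>x\<close> of a motion towards \<open>0\<close>. Whether \<open>0\<close> is
  stable or not, one step of the recursion increases \<open>F\<close> by \<open>1\<close>. For \<open>\<epsilon> = \<delta>\<^sup>m\<close> this has two
  consequences. First, consecutive points below \<open>\<delta>\<close> are at distance \<open>O(\<epsilon>)\<close>, so that, up to a constant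
  factor, the \<open>\<epsilon>\<close>-neighbourhood of the sequence contains \<open>(0, \<delta>)\<close>. Secondly, only
  \<open>O(F \<delta>) = O(1 / \<delta>\<^sup>m\<^sup>-\<^sup>1)\<close> points exceed \<open>\<delta>\<close>, and their \<open>\<epsilon>\<close>-neighbourhoods have total length \<open>O(\<delta>)\<close>.
  Hence the measure of the \<open>\<epsilon>\<close>-neighbourhood is of the exact order \<open>\<delta> = \<epsilon> powr (1 / m)\<close>.
\<close>

section \<open>Box dimension from the measure of neighbourhoods\<close>

lemma open_parallel_body: "open (parallel_body A \<epsilon>)"
proof -
  have "parallel_body A \<epsilon> = (\<Union>a\<in>A. ball a \<epsilon>)"
    by (auto simp: parallel_body_def dist_commute)
  then show ?thesis by (simp add: open_UN)
qed

text \<open>The content quotient lies between multiples of \<open>\<epsilon> powr (s - d)\<close>.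
  This tends to 0 for \<open>s > d\<close> and is at least 1 for \<open>s \<le> d\<close> and
  \<open>\<epsilon> < 1\<close>. Since \<open>0 \<le> d\<close>, every \<open>s > d\<close> is
  positive, so both infima are taken over \<open>{d<..}\<close>.\<close>

lemma has_box_dim_if_emeasure_bounds:
  fixes A :: "'a::euclidean_space set"
  assumes "bounded A" "0 \<le> d" "0 < c" "0 < C"
    and lower: "\<forall>\<^sub>F \<epsilon> in at_right 0.
      ennreal (c * \<epsilon> powr (real DIM('a) - d)) \<le> emeasure lebesgue (parallel_body A \<epsilon>)"
    and upper: "\<forall>\<^sub>F \<epsilon> in at_right 0.
      emeasure lebesgue (parallel_body A \<epsilon>) \<le> ennreal (C * \<epsilon> powr (real DIM('a) - d))"
  shows "has_box_dim A d"
proof -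
  define q where "q s \<epsilon> = emeasure lebesgue (parallel_body A \<epsilon>) / ennreal (\<epsilon> powr (real DIM('a) - s))"
    for s \<epsilon>
  have quot: "ennreal (K * \<epsilon> powr (real DIM('a) - d)) / ennreal (\<epsilon> powr (real DIM('a) - s)) =
      ennreal (K * \<epsilon> powr (s - d))" if "0 < \<epsilon>" "0 < K" for \<epsilon> K s :: real
  proof -
    have "ennreal (K * \<epsilon> powr (real DIM('a) - d)) / ennreal (\<epsilon> powr (real DIM('a) - s)) =
      ennreal (K * \<epsilon> powr (real DIM('a) - d) / \<epsilon> powr (real DIM('a) - s))"
      using that by (intro divide_ennreal) auto
    also have "K * \<epsilon> powr (real DIM('a) - d) / \<epsilon> powr (real DIM('a) - s) = K * \<epsilon> powr (s - d)"
      by (simp flip: powr_diff times_divide_eq_right)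
    finally show ?thesis .
  qed
  have up: "upper_content s A = 0" if "d < s" for s
  proof -
    have "\<forall>\<^sub>F \<epsilon> in at_right 0. q s \<epsilon> \<le> ennreal (C * \<epsilon> powr (s - d))"
      using upper eventually_at_right_less[of 0]
    proof eventually_elim
      case (elim \<epsilon>)
      then show ?case
        using quot[of \<epsilon> C s] \<open>0 < C\<close> unfolding q_def by (metis divide_right_mono_ennreal)
    qed
    moreover have "((\<lambda>\<epsilon>. ennreal (C * \<epsilon> powr (s - d))) \<longlongrightarrow> ennreal (C * 0)) (at_right 0)"
      using that by (intro tendsto_ennrealI tendsto_mult tendsto_const tendsto_neg_powr
        tendsto_zero_powrI[where b = "s - d"]) (auto intro: tendsto_ident_at simp: eventually_at_filter)
    ultimately have "(q s \<longlongrightarrow> 0) (at_right 0)"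
      using tendsto_sandwich[of "\<lambda>_. 0" "q s" "at_right 0" "\<lambda>\<epsilon>. ennreal (C * \<epsilon> powr (s - d))" 0]
      by simp
    then show ?thesis
      unfolding upper_content_def q_def[symmetric, abs_def] by (intro lim_imp_Limsup) auto
  qed
  have le: "lower_content s A \<le> upper_content s A" for s
    unfolding lower_content_def upper_content_def by (intro Liminf_le_Limsup) auto
  have lo: "lower_content s A \<noteq> 0" if "s \<le> d" for s
  proof -
    have "\<forall>\<^sub>F \<epsilon> in at_right (0::real). \<epsilon> < 1"
      by (rule eventually_at_right_real[THEN eventually_mono]) (auto)
    with lower eventually_at_right_less[of 0] have "\<forall>\<^sub>F \<epsilon> in at_right 0. ennreal c \<le> q s \<epsilon>"
    proof eventually_elim
      case (elim \<epsilon>)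
      have "ennreal c \<le> ennreal (c * \<epsilon> powr (s - d))"
        using elim that \<open>0 < c\<close> powr_mono'[of "s - d" 0 \<epsilon>] by (intro ennreal_leI) auto
      also have "\<dots> \<le> q s \<epsilon>"
        using quot[of \<epsilon> c s] elim \<open>0 < c\<close> unfolding q_def by (metis divide_right_mono_ennreal)
      finally show ?case .
    qed
    then have "ennreal c \<le> lower_content s A"
      unfolding lower_content_def q_def[symmetric, abs_def] by (rule Liminf_bounded)
    then show ?thesis
      using \<open>0 < c\<close> by (metis ennreal_eq_0_iff le_zero_eq not_le)
  qed
  have "{s. 0 < s \<and> lower_content s A = 0} = {d<..}" "{s. 0 < s \<and> upper_content s A = 0} = {d<..}"
    using up lo le \<open>0 \<le> d\<close> by (auto simp: not_le[symmetric]) (metis le_zero_eq linorder_not_le)+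
  moreover have "Inf (ereal ` {d<..}) = ereal d"
  proof (rule Inf_eqI)
    fix y assume y: "\<And>i. i \<in> ereal ` {d<..} \<Longrightarrow> y \<le> i"
    have "y \<le> ereal d + ereal e" if "0 < e" for e
      using y[of "ereal (d + e)"] that by simp
    then show "y \<le> ereal d" by (rule ereal_le_epsilon2)
  qed auto
  ultimately show ?thesis
    using \<open>bounded A\<close> unfolding has_box_dim_def lower_box_dim_def upper_box_dim_def by simp
qed

section \<open>Motions whose speed is comparable to a power\<close>

text \<open>\<open>1 / (c * real k * z ^ k)\<close> is the time that a motion with speed exactly
  \<open>c * z ^ Suc k\<close> takes from infinity down to \<open>z\<close>. It is the comparison
  function for \<open>F\<close> below.\<close>

lemma has_real_derivative_inverse_power:
  fixes c z :: real
  assumes "0 < k" "0 < z" "0 < c"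
  shows "((\<lambda>z. 1 / (c * real k * z ^ k)) has_real_derivative - 1 / (c * z ^ Suc k)) (at z)"
proof -
  have "((\<lambda>z. inverse (c * real k * z ^ k)) has_real_derivative
      - (inverse (c * real k * z ^ k) * (c * real k * (real k * z ^ (k - Suc 0))) *
         inverse (c * real k * z ^ k))) (at z)"
    using assms by (intro DERIV_inverse' DERIV_cmult DERIV_pow) auto
  moreover have "z ^ k = z * z ^ (k - Suc 0)" using assms by (simp flip: power_Suc)
  ultimately show ?thesis
    using assms by (simp add: inverse_eq_divide divide_simps mult_ac)
qed

text \<open>\<open>F x\<close> is, up to a constant, the time that a motion with speed \<open>h\<close> towards \<open>0\<close> needs to
  arrive at \<open>x\<close>.\<close>

locale power_speed =
  fixes h F :: "real \<Rightarrow> real" and k :: nat and a b r :: real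
  assumes k: "0 < k" and a: "0 < a" and b: "0 < b" and r: "0 < r" and br: "b * r ^ k \<le> 1 / 2"
    and h_ge: "\<And>x. 0 < x \<Longrightarrow> x < r \<Longrightarrow> a * x ^ Suc k \<le> h x"
    and h_le: "\<And>x. 0 < x \<Longrightarrow> x < r \<Longrightarrow> h x \<le> b * x ^ Suc k"
    and F: "\<And>x. 0 < x \<Longrightarrow> x < r \<Longrightarrow> (F has_real_derivative - 1 / h x) (at x)"
begin

lemma h_pos: "0 < x \<Longrightarrow> x < r \<Longrightarrow> 0 < h x"
  using h_ge[of x] a by (smt (verit) mult_pos_pos zero_less_power)

lemma F_less:
  assumes "0 < x" "x < y" "y < r"
  shows "F y < F x"
  using assms F h_pos by (intro DERIV_neg_imp_decreasing[OF \<open>x < y\<close>]) (smt (verit) divide_neg_pos)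

lemma F_le_iff: "0 < x \<Longrightarrow> x < r \<Longrightarrow> 0 < y \<Longrightarrow> y < r \<Longrightarrow> F x \<le> F y \<longleftrightarrow> y \<le> x"
  using F_less[of x y] F_less[of y x] by (cases x y rule: linorder_cases) auto

lemma inj_on_F: "inj_on F {0<..<r}"
  by (rule linorder_inj_onI') (use F_less in force)

lemma isCont_F: "0 < x \<Longrightarrow> x < r \<Longrightarrow> isCont F x"
  using F DERIV_isCont by blast

text \<open>A motion at least as fast as \<open>a * z ^ Suc k\<close> arrives no later than the
  model motion; the model's time at \<open>y\<close> is simply dropped. This bounds the number of
  points above a given level.\<close>

lemma F_diff_le:
  assumes "0 < x" "x \<le> y" "y < r"
  shows "F x - F y \<le> 1 / (a * real k * x ^ k)"
proof -
  have "F x - 1 / (a * real k * x ^ k) \<le> F y - 1 / (a * real k * y ^ k)"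
  proof (rule DERIV_nonneg_imp_nondecreasing[OF \<open>x \<le> y\<close>])
    fix z assume z: "x \<le> z" "z \<le> y"
    have "1 / h z \<le> 1 / (a * z ^ Suc k)"
      using h_ge[of z] z assms a h_pos[of z] by (intro divide_left_mono) (auto intro!: mult_pos_pos)
    then show "\<exists>D. ((\<lambda>z. F z - 1 / (a * real k * z ^ k)) has_real_derivative D) (at z) \<and> 0 \<le> D"
      using z assms a b k
      by (intro exI[of _ "- 1 / h z - - 1 / (a * z ^ Suc k)"] conjI DERIV_diff F
          has_real_derivative_inverse_power) auto
  qed
  moreover have "0 \<le> 1 / (a * real k * y ^ k)" using assms a by simp
  ultimately show ?thesis by linarith
qed

text \<open>Comparison with the faster model motion. It forces \<open>F\<close> to infinity at
  0.\<close>

lemma F_diff_ge: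
  assumes "0 < x" "x \<le> y" "y < r"
  shows "1 / (b * real k * x ^ k) - 1 / (b * real k * y ^ k) \<le> F x - F y"
proof -
  have "F y - 1 / (b * real k * y ^ k) \<le> F x - 1 / (b * real k * x ^ k)"
  proof (rule DERIV_nonpos_imp_nonincreasing[OF \<open>x \<le> y\<close>])
    fix z assume z: "x \<le> z" "z \<le> y"
    have "1 / (b * z ^ Suc k) \<le> 1 / h z"
      using h_le[of z] z assms b h_pos[of z] by (intro divide_left_mono) (auto intro!: mult_pos_pos)
    then show "\<exists>D. ((\<lambda>z. F z - 1 / (b * real k * z ^ k)) has_real_derivative D) (at z) \<and> D \<le> 0"
      using z assms a b k
      by (intro exI[of _ "- 1 / h z - - 1 / (b * z ^ Suc k)"] conjI DERIV_diff F
          has_real_derivative_inverse_power) auto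
  qed
  then show ?thesis by linarith
qed

text \<open>The motion does not reach 0 in finite time: \<open>F\<close> is continuous and unbounded
  near 0, so the intermediate value theorem applies.\<close>

lemma F_attains:
  assumes "0 < x" "x < r" "F x \<le> t"
  obtains y where "0 < y" "y \<le> x" "F y = t"
proof -
  \<comment> \<open>\<open>B\<close> is the size that \<open>1 / (b * real k * z ^ k)\<close> must
    reach for \<open>F z\<close> to exceed \<open>t\<close>. The summands \<open>1 / x\<close> and
    \<open>1\<close> ensure \<open>z < x\<close> and \<open>z \<le> 1\<close>; the latter gives
    \<open>z ^ k \<le> z\<close>, so that a bound linear in \<open>1 / z\<close> suffices.\<close>
  define B where "B = t - F x + 1 / (b * real k * x ^ k) + 1 / x + 1"
  have "0 < 1 / (b * real k * x ^ k)" using assms k b by simp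
  moreover have "0 < 1 / x" using assms by simp
  ultimately have B: "1 < B" "1 / x < B" "t - F x + 1 / (b * real k * x ^ k) \<le> B"
    using assms unfolding B_def by linarith+
  define z where "z = 1 / (B * (1 + b * real k))"
  have bk: "0 < b * real k" using b k by simp
  then have z: "0 < z" "z \<le> 1"
    using B by (auto simp: z_def mult_le_one intro!: divide_le_eq_1_pos[THEN iffD2])
      (smt (verit) mult_less_cancel_right2)
  have "z \<le> 1 / B" unfolding z_def using B bk by (intro divide_left_mono) auto
  also have "\<dots> < x" using B assms by (simp add: field_simps)
  finally have "z < x" .
  have "B \<le> B * (1 + b * real k) / (b * real k)" using B bk by (simp add: field_simps)
  also have "\<dots> = 1 / (b * real k * z)" by (simp add: z_def)
  also have "\<dots> \<le> 1 / (b * real k * z ^ k)"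
  proof (intro divide_left_mono mult_left_mono)
    show "z ^ k \<le> z" using z k power_decreasing[of 1 k z] by simp
  qed (use bk z in auto)
  finally have "t \<le> F z"
    using F_diff_ge[of z x] \<open>z < x\<close> z assms B by linarith
  then obtain y where "z \<le> y" "y \<le> x" "F y = t"
    using IVT2[of F x t z] assms z \<open>z < x\<close> isCont_F by force
  with z show thesis by (intro that[of y]) auto
qed

definition G :: "real \<Rightarrow> real" where "G = the_inv_into {0<..<r} F"

lemma G_F: "0 < x \<Longrightarrow> x < r \<Longrightarrow> G (F x) = x"
  unfolding G_def by (rule the_inv_into_f_f[OF inj_on_F]) simp

text \<open>Inverse function rule: the reciprocal of \<open>- 1 / h x\<close> is
  \<open>- h x\<close>. Hence \<open>G\<close>, the position as a function of arrival time, solves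
  the equation with right-hand side \<open>- h\<close>.\<close>

lemma has_real_derivative_G:
  assumes "0 < x" "x < r"
  shows "(G has_real_derivative - h x) (at (F x))"
proof -
  have "(G has_derivative (*) (- h x)) (at (F x))"
    by (rule has_derivative_inverse_strong[where S = "{0<..<r}" and f' = "(*) (- 1 / h x)"])
      (use assms F[of x] h_pos[of x] in \<open>auto simp: G_F isCont_F continuous_on_eq_continuous_at
        fun_eq_iff dest: has_field_derivative_imp_has_derivative\<close>)
  then show ?thesis by (simp add: has_field_derivative_def)
qed

text \<open>By the mean value theorem a unit increase of \<open>F\<close> covers the distance
  \<open>h z\<close> for some \<open>z\<close> between \<open>y\<close> and \<open>x\<close>. As
  \<open>b * r ^ k \<le> 1 / 2\<close>, this is at most half of \<open>x\<close>; a point is thus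
  controlled by its successor.\<close>

lemma step_le:
  assumes "0 < x" "x < r" "0 < y" "y < r" "F y = F x + 1"
  shows "y < x" "x - y \<le> b * x ^ Suc k" "x \<le> 2 * y"
proof -
  show "y < x" using F_le_iff[of y x] assms by force
  then obtain z where z: "y < z" "z < x" "F x - F y = (x - y) * (- 1 / h z)"
    using MVT2[of y x F "\<lambda>z. - 1 / h z"] F assms by force
  have "x - y = h z" using z assms h_pos[of z] by (simp add: field_simps)
  also have "\<dots> \<le> b * z ^ Suc k" using h_le[of z] z assms by simp
  also have "\<dots> \<le> b * x ^ Suc k"
    using b z assms by (intro mult_left_mono power_mono) auto
  finally show le: "x - y \<le> b * x ^ Suc k" .
  have "b * x ^ Suc k = (b * x ^ k) * x" by simp
  also have "\<dots> \<le> (b * r ^ k) * x"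
    using assms b by (intro mult_right_mono mult_left_mono power_mono) auto
  also have "\<dots> \<le> (1 / 2) * x" using assms br by (intro mult_right_mono) auto
  finally show "x \<le> 2 * y" using le by linarith
qed

section \<open>Sequences along which \<open>F\<close> grows by 1 per step\<close>

context
  fixes x :: "nat \<Rightarrow> real"
  assumes x_in: "\<And>n. 1 \<le> n \<Longrightarrow> 0 < x n \<and> x n < r"
    and F_step: "\<And>n. 1 \<le> n \<Longrightarrow> F (x (Suc n)) = F (x n) + 1"
begin

lemma F_seq: "F (x (Suc n)) = F (x 1) + real n"
  by (induction n) (auto simp: F_step)

lemma seq_le_first: "1 \<le> n \<Longrightarrow> x n \<le> x 1"
  using F_seq[of "n - 1"] x_in[of 1] x_in[of n] F_le_iff[of "x 1" "x n"] by simp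

text \<open>If all points exceeded \<open>y\<close>, then \<open>F y\<close> would bound the
  unbounded sequence \<open>F (x n)\<close>.\<close>

lemma seq_le_any:
  assumes "0 < y"
  shows "\<exists>n\<ge>1. x n \<le> y"
proof (rule ccontr)
  assume *: "\<not> ?thesis"
  obtain n where n: "F y - F (x 1) < real n" using reals_Archimedean2 by blast
  have "y < x (Suc n)" using * by (metis le_add1 not_le plus_1_eq_Suc)
  then have "F (x (Suc n)) < F y" using F_less assms x_in[of "Suc n"] by simp
  with n F_seq[of n] show False by simp
qed

text \<open>A point \<open>y < \<delta>\<close> lies between consecutive points
  \<open>x n \<le> y < x i\<close>. Since \<open>x i \<le> 2 * x n < 2 * \<delta>\<close>, the gap
  is at most \<open>b * (2 * \<delta>) ^ Suc k\<close>.\<close>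

lemma Ioo_subset_parallel_body:
  assumes "0 < \<delta>" "\<delta> < x 1" "b * (2 * \<delta>) ^ Suc k \<le> \<epsilon>"
  shows "{0<..<\<delta>} \<subseteq> parallel_body (x ` {1..}) \<epsilon>"
proof
  fix y assume y: "y \<in> {0<..<\<delta>}"
  define n where "n = (LEAST n. 1 \<le> n \<and> x n \<le> y)"
  have n: "1 \<le> n" "x n \<le> y"
    using LeastI_ex[OF seq_le_any[of y, unfolded Bex_def]] y by (auto simp: n_def)
  \<comment> \<open>\<open>\<delta> < x 1\<close> guarantees that the first point not above
    \<open>y\<close> has a predecessor in the sequence.\<close>
  have "n \<noteq> 1" using n y assms by auto
  with n obtain i where i: "n = Suc i" "1 \<le> i" by (cases n) auto
  have "y < x i" using not_less_Least[of i "\<lambda>n. 1 \<le> n \<and> x n \<le> y"] i by (auto simp: n_def)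
  have s: "x i - x n \<le> b * x i ^ Suc k" "x i \<le> 2 * x n"
    using step_le[of "x i" "x n"] x_in[of i] x_in[of n] n i F_step by auto
  have "dist y (x n) < x i - x n" using n \<open>y < x i\<close> by (simp add: dist_real_def)
  also have "\<dots> \<le> b * x i ^ Suc k" by fact
  also have "\<dots> \<le> b * (2 * \<delta>) ^ Suc k"
    using s n y b x_in[of i] i by (intro mult_left_mono power_mono) auto
  finally show "y \<in> parallel_body (x ` {1..}) \<epsilon>"
    using assms n by (force simp: parallel_body_def)
qed

text \<open>Points up to \<open>\<delta>\<close> share one interval. For a point above
  \<open>\<delta>\<close>, the value of \<open>F\<close>, which counts the steps, is below
  \<open>F \<delta>\<close>, and this bounds its index by \<open>N\<close>.\<close>

lemma parallel_body_subset:
  assumes "0 < \<delta>" "\<delta> < 1" "\<delta> < r" "0 < \<epsilon>"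
  defines "N \<equiv> nat \<lfloor>(1 + 1 / (a * real k)) / \<delta> ^ k\<rfloor>"
  shows "parallel_body (x ` {1..}) \<epsilon> \<subseteq> {-\<epsilon><..<\<delta> + \<epsilon>} \<union> (\<Union>n\<in>{1..N}. {x n - \<epsilon><..<x n + \<epsilon>})"
proof
  fix y assume "y \<in> parallel_body (x ` {1..}) \<epsilon>"
  then obtain n where n: "1 \<le> n" "dist y (x n) < \<epsilon>" by (auto simp: parallel_body_def)
  show "y \<in> {-\<epsilon><..<\<delta> + \<epsilon>} \<union> (\<Union>n\<in>{1..N}. {x n - \<epsilon><..<x n + \<epsilon>})"
  proof (cases "x n \<le> \<delta>")
    case True
    with n x_in[of n] show ?thesis by (auto simp: dist_real_def)
  next
    case False
    have "F (x n) = F (x 1) + (real n - 1)" using F_seq[of "n - 1"] n by (simp add: of_nat_diff)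
    moreover have "F (x n) < F \<delta>" using F_less[of \<delta> "x n"] False assms x_in[of n] n by simp
    moreover have "F \<delta> - F (x 1) \<le> 1 / (a * real k * \<delta> ^ k)"
      using F_diff_le[of \<delta> "x 1"] False seq_le_first[of n] n assms x_in[of 1] by simp
    \<comment> \<open>The index starts at 1, so the time estimate bounds \<open>n - 1\<close>; the
      extra 1 is absorbed into the summand 1 of the constant in \<open>N\<close>.\<close>
    moreover have "1 \<le> 1 / \<delta> ^ k" using assms by (simp add: power_le_one)
    ultimately have "real n \<le> 1 / \<delta> ^ k + 1 / (a * real k * \<delta> ^ k)" by linarith
    also have "\<dots> = (1 + 1 / (a * real k)) / \<delta> ^ k" by (simp add: field_simps add_divide_distrib)
    finally have "n \<le> N" unfolding N_def by (simp add: le_nat_floor)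
    with n have "n \<in> {1..N}" "y \<in> {x n - \<epsilon><..<x n + \<epsilon>}" by (auto simp: dist_real_def)
    then show ?thesis by blast
  qed
qed

lemma emeasure_parallel_body_le:
  assumes "0 < \<delta>" "\<delta> < 1" "\<delta> < r"
  shows "emeasure lebesgue (parallel_body (x ` {1..}) (\<delta> ^ Suc k))
    \<le> ennreal ((5 + 2 / (a * real k)) * \<delta>)"
proof -
  define \<epsilon> where "\<epsilon> = \<delta> ^ Suc k"
  define K where "K = 1 + 1 / (a * real k)"
  define N where "N = nat \<lfloor>K / \<delta> ^ k\<rfloor>"
  have \<epsilon>: "0 < \<epsilon>" "\<epsilon> \<le> \<delta>" using assms power_decreasing[of 1 "Suc k" \<delta>] by (auto simp: \<epsilon>_def)
  have "0 < K" using a k by (simp add: K_def add_pos_pos)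
  have len: "emeasure lebesgue {u<..<v} = ennreal (v - u)" if "u \<le> v" for u v :: real
    using that by simp
  have "emeasure lebesgue (parallel_body (x ` {1..}) \<epsilon>) \<le>
      emeasure lebesgue ({-\<epsilon><..<\<delta> + \<epsilon>} \<union> (\<Union>n\<in>{1..N}. {x n - \<epsilon><..<x n + \<epsilon>}))"
    using parallel_body_subset[OF assms \<open>0 < \<epsilon>\<close>] unfolding N_def K_def
    by (intro emeasure_mono sets.Un sets.finite_UN) auto
  also have "\<dots> \<le> emeasure lebesgue {-\<epsilon><..<\<delta> + \<epsilon>} +
      emeasure lebesgue (\<Union>n\<in>{1..N}. {x n - \<epsilon><..<x n + \<epsilon>})"
    by (intro emeasure_subadditive sets.finite_UN) auto
  also have "\<dots> \<le> emeasure lebesgue {-\<epsilon><..<\<delta> + \<epsilon>} +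
      (\<Sum>n\<in>{1..N}. emeasure lebesgue {x n - \<epsilon><..<x n + \<epsilon>})"
    by (intro add_left_mono emeasure_subadditive_finite) auto
  also have "\<dots> = ennreal (\<delta> + 2 * \<epsilon> + real N * (2 * \<epsilon>))"
    using \<epsilon> assms by (simp add: len ennreal_of_nat_eq_real_of_nat flip: ennreal_plus ennreal_mult)
  also have "\<dots> \<le> ennreal ((5 + 2 / (a * real k)) * \<delta>)"
  proof (rule ennreal_leI)
    have "real N \<le> K / \<delta> ^ k" using \<open>0 < K\<close> assms by (simp add: N_def)
    then have "real N * (2 * \<epsilon>) \<le> K / \<delta> ^ k * (2 * \<epsilon>)" using \<epsilon> by (intro mult_right_mono) auto
    also have "\<dots> = 2 * K * \<delta>" using assms by (simp add: \<epsilon>_def)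
    \<comment> \<open>With \<open>\<epsilon> \<le> \<delta>\<close> the total is at most
      \<open>(3 + 2 * K) * \<delta>\<close>, and \<open>3 + 2 * K\<close> is the stated
      constant.\<close>
    finally show "\<delta> + 2 * \<epsilon> + real N * (2 * \<epsilon>) \<le> (5 + 2 / (a * real k)) * \<delta>"
      using \<epsilon> by (simp add: K_def algebra_simps)
  qed
  finally show ?thesis unfolding \<epsilon>_def .
qed

lemma has_box_dim_seq: "has_box_dim (x ` {1..}) (1 - 1 / real (Suc k))"
proof (rule has_box_dim_if_emeasure_bounds)
  define p where "p = 1 / real (Suc k)"
  \<comment> \<open>Chosen so that \<open>\<delta> = c * \<epsilon> powr p\<close> satisfies
    \<open>b * (2 * \<delta>) ^ Suc k = \<epsilon>\<close>, the borderline case of the covering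
    condition. The exponent is \<open>p = 1 - d\<close> for the claimed dimension
    \<open>d\<close>.\<close>
  define c where "c = (1 / (b * 2 ^ Suc k)) powr p"
  have c: "0 < c" using b by (simp add: c_def)
  have root: "(y powr p) ^ Suc k = y" if "0 < y" for y
    using that by (simp add: p_def powr_power del: power_Suc of_nat_Suc)
  \<comment> \<open>The covering needs \<open>\<delta> < x 1\<close>, the measure bound
    \<open>\<delta> < 1\<close> and \<open>\<delta> < r\<close>; all hold for small
    \<open>\<epsilon>\<close>.\<close>
  have small: "\<forall>\<^sub>F \<epsilon> in at_right 0. K * \<epsilon> powr p < e" if "0 < e" for K e
  proof -
    have "((\<lambda>\<epsilon>. K * \<epsilon> powr p) \<longlongrightarrow> K * 0) (at_right 0)"
      by (intro tendsto_mult tendsto_const tendsto_zero_powrI[where b = p])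
        (auto intro: tendsto_ident_at simp: eventually_at_filter p_def)
    then show ?thesis using that by (auto dest: order_tendstoD(2))
  qed
  show "bounded (x ` {1..})"
    unfolding bounded_iff using x_in by (auto intro!: exI[of _ r] simp: abs_le_iff less_imp_le) (smt (verit) x_in)
  show "0 \<le> 1 - 1 / real (Suc k)" by simp
  show "0 < c" by fact
  show "0 < 5 + 2 / (a * real k)" using a by (simp add: add_pos_nonneg)
  show "\<forall>\<^sub>F \<epsilon> in at_right 0. ennreal (c * \<epsilon> powr (real DIM(real) - (1 - 1 / real (Suc k)))) \<le>
      emeasure lebesgue (parallel_body (x ` {1..}) \<epsilon>)"
    using small[OF x_in[THEN conjunct1, of 1], of c, simplified] eventually_at_right_less[of 0]
  proof eventually_elim
    case (elim \<epsilon>)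
    define \<delta> where "\<delta> = c * \<epsilon> powr p"
    have "\<delta> ^ Suc k = 1 / (b * 2 ^ Suc k) * \<epsilon>"
      unfolding \<delta>_def power_mult_distrib c_def using b elim
      by (simp only: root zero_less_divide_1_iff mult_pos_pos zero_less_power zero_less_numeral)
    then have "b * (2 * \<delta>) ^ Suc k = \<epsilon>" using b by (simp only: power_mult_distrib) simp
    then have "{0<..<\<delta>} \<subseteq> parallel_body (x ` {1..}) \<epsilon>"
      using elim c by (intro Ioo_subset_parallel_body) (auto simp: \<delta>_def)
    then have "emeasure lebesgue {0<..<\<delta>} \<le> emeasure lebesgue (parallel_body (x ` {1..}) \<epsilon>)"
      by (rule emeasure_mono) (simp add: open_parallel_body borel_open)
    then show ?case using c by (simp add: \<delta>_def p_def)
  qed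
  show "\<forall>\<^sub>F \<epsilon> in at_right 0. emeasure lebesgue (parallel_body (x ` {1..}) \<epsilon>) \<le>
      ennreal ((5 + 2 / (a * real k)) * \<epsilon> powr (real DIM(real) - (1 - 1 / real (Suc k))))"
    using small[OF zero_less_one, of 1] small[OF r, of 1] eventually_at_right_less[of 0]
  proof eventually_elim
    case (elim \<epsilon>)
    then show ?case
      using emeasure_parallel_body_le[of "\<epsilon> powr p"] root[of \<epsilon>] by (simp add: p_def)
  qed
qed

end

end

section \<open>Autonomous equations on the line\<close>

text \<open>\<open>K\<close> may have gaps, across which the mean value theorem says nothing. The
  constant therefore comes from local Lipschitz continuity and compactness, with \<open>f\<close>
  read as independent of time.\<close>

lemma C1_lipschitz_on_compact:
  fixes f :: "real \<Rightarrow> real"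
  assumes "open U" "compact K" "K \<subseteq> U"
    and der: "\<And>x. x \<in> U \<Longrightarrow> f field_differentiable at x"
    and cont: "continuous_on U (deriv f)"
  obtains L where "L-lipschitz_on K f"
proof -
  have lip: "local_lipschitz (UNIV :: real set) U (\<lambda>t. f)"
  proof (rule c1_implies_local_lipschitz[where f' = "\<lambda>(t, x). blinfun_mult_left (deriv f x)"])
    show "(f has_derivative blinfun_apply (case (t, x) of (t, x) \<Rightarrow> blinfun_mult_left (deriv f x))) (at x)"
      if "x \<in> U" for t x
      using der[OF that] by (auto simp: field_differentiable_derivI has_field_derivative_imp_has_derivative
          DERIV_deriv_iff_field_differentiable[symmetric] has_field_derivative_def mult_commute_abs)
    show "continuous_on (UNIV \<times> U) (\<lambda>(t, x). blinfun_mult_left (deriv f x))"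
      unfolding split_beta
      by (intro bounded_linear.continuous_on[OF bounded_linear_blinfun_mult_left]
          continuous_on_compose2[OF cont]) (auto intro!: continuous_intros)
  qed (use assms in auto)
  obtain L where "\<And>t. t \<in> {0::real} \<Longrightarrow> L-lipschitz_on K f"
    by (rule local_lipschitz_compact_implies_lipschitz[OF
          local_lipschitz_subset[OF lip, of "{0}" K]]) (use assms in auto)
  then show thesis using that by blast
qed

lemma ode_solution_subset: "ode_solution f U T u \<Longrightarrow> S \<subseteq> T \<Longrightarrow> ode_solution f U S u"
  unfolding ode_solution_def by (blast intro: DERIV_subset)

lemma ode_solution_continuous_on: "ode_solution f U T u \<Longrightarrow> continuous_on T u"
  unfolding ode_solution_def by (meson DERIV_continuous_on)

text \<open>A Gronwall argument in both directions of time. The common time \<open>s\<close> is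
  arbitrary because injectivity of the unit-time map starts from agreement at time 1.\<close>

lemma ode_solution_unique:
  fixes f :: "real \<Rightarrow> real"
  assumes "open U" and der: "\<And>x. x \<in> U \<Longrightarrow> f field_differentiable at x"
    and cont: "continuous_on U (deriv f)"
    and u: "ode_solution f U {0..T} u" and v: "ode_solution f U {0..T} v"
    and eq: "u s = v s" "s \<in> {0..T}" and t: "t \<in> {0..T}"
  shows "u t = v t"
proof -
  have cont: "continuous_on {0..T} u" "continuous_on {0..T} v"
    using u v by (auto intro: ode_solution_continuous_on)
  then have "compact (u ` {0..T} \<union> v ` {0..T})"
    by (intro compact_Un compact_continuous_image) auto
  moreover have "u ` {0..T} \<union> v ` {0..T} \<subseteq> U" using u v by (auto simp: ode_solution_def)
  ultimately obtain L where L: "L-lipschitz_on (u ` {0..T} \<union> v ` {0..T}) f"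
    using C1_lipschitz_on_compact[OF \<open>open U\<close> _ _ der \<open>continuous_on U (deriv f)\<close>] by blast
  have lip: "\<bar>(u t - v t) * (f (u t) - f (v t))\<bar> \<le> L * (u t - v t)\<^sup>2" if "t \<in> {0..T}" for t
  proof -
    have "\<bar>f (u t) - f (v t)\<bar> \<le> L * \<bar>u t - v t\<bar>"
      using lipschitz_onD[OF L, of "u t" "v t"] that by (auto simp: dist_real_def)
    then have "\<bar>u t - v t\<bar> * \<bar>f (u t) - f (v t)\<bar> \<le> \<bar>u t - v t\<bar> * (L * \<bar>u t - v t\<bar>)"
      by (rule mult_left_mono) simp
    also have "\<dots> = L * (u t - v t)\<^sup>2" by (simp add: power2_eq_square)
    finally show ?thesis by (simp add: abs_mult)
  qed
  \<comment> \<open>The weight makes the squared distance nonincreasing for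
    \<open>c = - 2 * L\<close> and nondecreasing for \<open>c = 2 * L\<close>. Being 0 at
    \<open>s\<close>, it is then at most 0 after, respectively before, \<open>s\<close>.\<close>
  define w where "w c t = (u t - v t)\<^sup>2 * exp (c * t)" for c t
  have dw: "(w c has_real_derivative
      (2 * ((u t - v t) * (f (u t) - f (v t))) + c * (u t - v t)\<^sup>2) * exp (c * t)) (at t)"
    if "0 < t" "t < T" for c t
  proof -
    have "at t within {0..T} = at t" using that by (simp add: at_within_Icc_at)
    then have "(u has_real_derivative f (u t)) (at t)" "(v has_real_derivative f (v t)) (at t)"
      using u v that unfolding ode_solution_def by (metis atLeastAtMost_iff less_imp_le)+
    then show ?thesis unfolding w_def[abs_def]
      by (auto intro!: derivative_eq_intros simp: algebra_simps)
  qed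
  have cw: "continuous_on {p..q} (w c)" if "0 \<le> p" "q \<le> T" for p q c
    unfolding w_def[abs_def] using that
    by (intro continuous_intros continuous_on_subset[OF cont(1)] continuous_on_subset[OF cont(2)]) auto
  have ws: "w c s = 0" for c using eq by (simp add: w_def)
  have "\<exists>c. w c t \<le> 0"
  proof (cases "s \<le> t")
    case True
    have "w (- 2 * L) t \<le> w (- 2 * L) s"
    proof (rule DERIV_nonpos_imp_decreasing_open[where f = "w (- 2 * L)", OF True])
      fix x assume "s < x" "x < t"
      with eq t have x: "0 < x" "x < T" by auto
      have "2 * ((u x - v x) * (f (u x) - f (v x))) + - 2 * L * (u x - v x)\<^sup>2 \<le> 0"
        using lip[of x] x by (simp add: abs_le_iff)
      from dw[OF x] mult_nonpos_nonneg[OF this exp_ge_zero]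
      show "\<exists>y. (w (- 2 * L) has_real_derivative y) (at x) \<and> y \<le> 0" by blast
    qed (use eq t in \<open>auto intro!: cw\<close>)
    then show ?thesis using ws by metis
  next
    case False
    have "w (2 * L) t \<le> w (2 * L) s"
    proof (rule DERIV_nonneg_imp_increasing_open[where f = "w (2 * L)"])
      fix x assume "t < x" "x < s"
      with eq t have x: "0 < x" "x < T" by auto
      have "0 \<le> 2 * ((u x - v x) * (f (u x) - f (v x))) + 2 * L * (u x - v x)\<^sup>2"
        using lip[of x] x by (simp add: abs_le_iff)
      from dw[OF x] mult_nonneg_nonneg[OF this exp_ge_zero]
      show "\<exists>y. (w (2 * L) has_real_derivative y) (at x) \<and> 0 \<le> y" by blast
    qed (use False eq t in \<open>auto intro!: cw\<close>)
    then show ?thesis using ws by metis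
  qed
  then obtain c where "(u t - v t)\<^sup>2 * exp (c * t) \<le> 0" by (auto simp: w_def)
  then have "(u t - v t)\<^sup>2 \<le> 0" by (simp add: mult_le_0_iff)
  then show ?thesis by simp
qed

section \<open>The unit-time map and its inverse\<close>

locale C1_ode =
  fixes f :: "real \<Rightarrow> real" and U :: "real set"
  assumes open_U: "open U" and diff: "\<And>x. x \<in> U \<Longrightarrow> f field_differentiable at x"
    and cont: "continuous_on U (deriv f)"
begin

lemma unique:
  "ode_solution f U {0..T} u \<Longrightarrow> ode_solution f U {0..T} v \<Longrightarrow> u s = v s \<Longrightarrow> s \<in> {0..T} \<Longrightarrow>
    t \<in> {0..T} \<Longrightarrow> u t = v t"
  by (rule ode_solution_unique[OF open_U diff cont])

text \<open>Uniqueness from time 0 onwards makes the description in \<open>flow_map\<close> denote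
  the endpoint of any given solution.\<close>

lemma unit_time_map_eq:
  assumes u: "ode_solution f U {0..1} u"
  shows "unit_time_map f U (u 0) = u 1" "u 0 \<in> flow_domain f U 1"
proof -
  show "unit_time_map f U (u 0) = u 1"
    unfolding unit_time_map_def flow_map_def
  proof (rule the_equality)
    fix y assume "\<exists>v. ode_solution f U (closed_segment 0 1) v \<and> v 0 = u 0 \<and> v 1 = y"
    then show "y = u 1" using unique[OF _ u, of _ 0 1] by (auto simp: closed_segment_eq_real_ivl)
  qed (use u in \<open>auto simp: closed_segment_eq_real_ivl\<close>)
  show "u 0 \<in> flow_domain f U 1"
    using u by (auto simp: flow_domain_def closed_segment_eq_real_ivl)
qed

text \<open>Uniqueness backwards from time 1 makes the unit-time map injective, so
  \<open>inv_into\<close> returns the initial value.\<close>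

lemma unit_time_map_inv_eq:
  assumes u: "ode_solution f U {0..1} u"
  shows "unit_time_map_inv f U (u 1) = u 0"
proof -
  have "inj_on (unit_time_map f U) (flow_domain f U 1)"
  proof (rule inj_onI)
    fix p q assume "p \<in> flow_domain f U 1" "q \<in> flow_domain f U 1"
      and eq: "unit_time_map f U p = unit_time_map f U q"
    then obtain v w where v: "ode_solution f U {0..1} v" "v 0 = p" and w: "ode_solution f U {0..1} w" "w 0 = q"
      by (auto simp: flow_domain_def closed_segment_eq_real_ivl)
    with eq have "v 1 = w 1" using unit_time_map_eq by metis
    then show "p = q" using unique[OF v(1) w(1), of 1 0] v w by simp
  qed
  then show ?thesis
    unfolding unit_time_map_inv_def using unit_time_map_eq[OF u] by (metis inv_into_f_f)
qed

text \<open>The constant solution 0 is a barrier: meeting it once would mean coinciding with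
  it.\<close>

lemma solution_pos:
  assumes "0 \<in> U" "f 0 = 0" and u: "ode_solution f U {0..} u" and "0 < u 0" "0 \<le> t"
  shows "0 < u t"
proof (rule ccontr)
  assume "\<not> 0 < u t"
  moreover have u': "ode_solution f U {0..t} u" using ode_solution_subset[OF u] by simp
  ultimately obtain s where s: "0 \<le> s" "s \<le> t" "u s = 0"
    using IVT2'[of u t 0 0] assms ode_solution_continuous_on by (metis less_imp_le not_le)
  have "ode_solution f U {0..t} (\<lambda>_. 0)" using assms by (auto simp: ode_solution_def)
  then have "u 0 = 0" using unique[OF u', of "\<lambda>_. 0" s 0] s assms by simp
  with assms show False by simp
qed

end

text \<open>The sign \<open>\<sigma>\<close> is \<open>-1\<close> in the stable and \<open>1\<close> in the unstable case.\<close>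

locale power_ode = C1_ode f U + power_speed "\<lambda>x. \<bar>f x\<bar>" F k a b r
  for f U F k a b r +
  fixes \<sigma> :: real
  assumes U0: "0 \<in> U" and f0: "f 0 = 0" and Ioo_U: "{0<..<r} \<subseteq> U"
    and \<sigma>: "\<bar>\<sigma>\<bar> = 1" and f_sgn: "\<And>x. 0 < x \<Longrightarrow> x < r \<Longrightarrow> f x = \<sigma> * \<bar>f x\<bar>"
begin

text \<open>All times from \<open>F z\<close> on are values of \<open>F\<close>, so there
  \<open>G\<close> is a genuine inverse rather than an arbitrary value.\<close>

lemma G_range:
  assumes "0 < z" "z < r" "F z \<le> t"
  shows "0 < G t" "G t \<le> z" "F (G t) = t"
proof -
  obtain y where "0 < y" "y \<le> z" "F y = t" using F_attains[OF assms] .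
  then show "0 < G t" "G t \<le> z" "F (G t) = t" using G_F[of y] assms by auto
qed

text \<open>Along a solution in \<open>(0, r)\<close>, \<open>F\<close> changes at the constant rate
  \<open>- \<sigma>\<close>. The condition on \<open>T\<close> keeps the argument of
  \<open>G\<close> where \<open>G\<close> inverts \<open>F\<close>.\<close>

lemma ode_solution_G:
  assumes "0 < z" "z < r" and T: "\<And>t. t \<in> T \<Longrightarrow> F z \<le> p - \<sigma> * t"
  shows "ode_solution f U T (\<lambda>t. G (p - \<sigma> * t))"
  unfolding ode_solution_def
proof (intro ballI conjI)
  fix t assume t: "t \<in> T"
  note G = G_range[OF assms(1,2) T[OF t]]
  then have less: "G (p - \<sigma> * t) < r" using assms by simp
  with G Ioo_U show "G (p - \<sigma> * t) \<in> U" by auto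
  have "(G has_real_derivative - \<bar>f (G (p - \<sigma> * t))\<bar>) (at (p - \<sigma> * t))"
    using has_real_derivative_G[OF G(1) less] G(3) by simp
  then have "((\<lambda>t. G (p - \<sigma> * t)) has_real_derivative - \<bar>f (G (p - \<sigma> * t))\<bar> * (- \<sigma>)) (at t)"
    by (rule DERIV_chain2) (auto intro!: derivative_eq_intros)
  then show "((\<lambda>t. G (p - \<sigma> * t)) has_real_derivative f (G (p - \<sigma> * t))) (at t within T)"
    using f_sgn[OF G(1) less] by (simp add: mult.commute has_field_derivative_at_within)
qed

text \<open>The solution \<open>G (F x + t)\<close> never rises above its initial value
  \<open>x\<close>.\<close>

lemma stable_from_right_if_neg:
  assumes "\<sigma> = -1"
  shows "stable_from_right f U 0"
  unfolding stable_from_right_def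
proof (intro allI impI)
  fix \<epsilon> :: real assume "0 < \<epsilon>"
  show "\<exists>\<delta>>0. \<forall>x\<in>{0..<0 + \<delta>}. \<exists>u. ode_solution f U {0..} u \<and> u 0 = x \<and> (\<forall>t\<ge>0. \<bar>u t - 0\<bar> < \<epsilon>)"
  proof (intro exI[of _ "min r \<epsilon>"] conjI ballI)
    show "0 < min r \<epsilon>" using r \<open>0 < \<epsilon>\<close> by simp
    fix x assume x: "x \<in> {0..<0 + min r \<epsilon>}"
    show "\<exists>u. ode_solution f U {0..} u \<and> u 0 = x \<and> (\<forall>t\<ge>0. \<bar>u t - 0\<bar> < \<epsilon>)"
    proof (cases "x = 0")
      case True
      then show ?thesis using U0 f0 \<open>0 < \<epsilon>\<close>
        by (intro exI[of _ "\<lambda>_. 0"]) (auto simp: ode_solution_def)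
    next
      case False
      with x have x': "0 < x" "x < r" "x < \<epsilon>" by auto
      show ?thesis
      proof (intro exI conjI allI impI)
        show "ode_solution f U {0..} (\<lambda>t. G (F x - \<sigma> * t))"
          by (rule ode_solution_G[OF x'(1,2)]) (use assms in auto)
        show "\<bar>G (F x - \<sigma> * t) - 0\<bar> < \<epsilon>" if "0 \<le> t" for t
          using G_range[OF x'(1,2), of "F x - \<sigma> * t"] that assms x' by simp
      qed (use G_F x' in simp)
    qed
  qed
qed

text \<open>Stability fails for the tolerance \<open>r\<close>: a positive solution staying below
  \<open>r\<close> would be nondecreasing, hence would move with a speed of at least some
  \<open>e > 0\<close> and pass \<open>r\<close> by time \<open>r / e\<close>.\<close>

lemma not_stable_from_right_if_pos:
  assumes "\<sigma> = 1"
  shows "\<not> stable_from_right f U 0"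
proof
  assume "stable_from_right f U 0"
  then obtain \<delta> where "0 < \<delta>" and \<delta>: "\<And>x. x \<in> {0..<0 + \<delta>} \<Longrightarrow>
      \<exists>u. ode_solution f U {0..} u \<and> u 0 = x \<and> (\<forall>t\<ge>0. \<bar>u t - 0\<bar> < r)"
    using r unfolding stable_from_right_def by meson
  obtain u where u: "ode_solution f U {0..} u" and u0: "u 0 = \<delta> / 2" and "\<forall>t\<ge>0. \<bar>u t - 0\<bar> < r"
    using \<delta>[of "\<delta> / 2"] \<open>0 < \<delta>\<close> by auto
  then have ur: "u t < r" if "0 \<le> t" for t using that by (simp add: abs_less_iff)
  have up: "0 < u t" if "0 \<le> t" for t
    using solution_pos[OF U0 f0 u] u0 \<open>0 < \<delta>\<close> that by simp
  have fu: "a * u t ^ Suc k \<le> f (u t)" if "0 \<le> t" for t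
    using h_ge[OF up ur] f_sgn[OF up ur] assms that by simp
  have du: "(u has_real_derivative f (u t)) (at t)" if "0 < t" for t
  proof -
    have "at t within {0..} = at t" using that by (intro at_within_interior) simp
    then show ?thesis using u that unfolding ode_solution_def by (metis atLeast_iff less_imp_le)
  qed
  have cu: "continuous_on {0..t} u" for t
    by (rule continuous_on_subset[OF ode_solution_continuous_on[OF u]]) auto
  have ge: "\<delta> / 2 \<le> u t" if "0 \<le> t" for t
  proof -
    have "u 0 \<le> u t"
    proof (rule DERIV_nonneg_imp_increasing_open[OF that _ cu])
      fix s assume "0 < s" "s < t"
      then show "\<exists>y. (u has_real_derivative y) (at s) \<and> 0 \<le> y"
        using du fu[of s] up[of s] a by (intro exI conjI du) (auto intro: order_trans[OF _ fu[of s]])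
    qed
    with u0 show ?thesis by simp
  qed
  define e where "e = a * (\<delta> / 2) ^ Suc k"
  have "0 < e" using a \<open>0 < \<delta>\<close> by (simp add: e_def)
  have "u 0 - e * 0 \<le> u t - e * t" if "0 \<le> t" for t
  proof (rule DERIV_nonneg_imp_increasing_open[OF that])
    fix s assume "0 < s" "s < t"
    have "e \<le> a * u s ^ Suc k"
      unfolding e_def using a ge[of s] \<open>0 < s\<close> \<open>0 < \<delta>\<close> by (intro mult_left_mono power_mono) auto
    then have "e \<le> f (u s)" using fu[of s] \<open>0 < s\<close> by simp
    then show "\<exists>y. ((\<lambda>t. u t - e * t) has_real_derivative y) (at s) \<and> 0 \<le> y"
      by (intro exI[of _ "f (u s) - e"] conjI DERIV_diff du \<open>0 < s\<close> DERIV_cmult_Id) simp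
  qed (intro continuous_intros cu)
  from this[of "r / e"] show False
    using ur[of "r / e"] r \<open>0 < e\<close> u0 \<open>0 < \<delta>\<close> by simp
qed

definition step :: "real \<Rightarrow> real" where
  "step x = (if stable_from_right f U 0 then unit_time_map f U x else unit_time_map_inv f U x)"

text \<open>Choosing the inverse map in the unstable case compensates for the sign of
  \<open>f\<close>, so both cases are the shift by 1 in the coordinate \<open>F\<close>.\<close>

lemma step_eq:
  assumes "0 < x" "x < r"
  shows "step x = G (F x + 1)"
proof (cases "\<sigma> = 1")
  case True
  \<comment> \<open>This solution ends at \<open>x\<close> at time 1; the inverse map returns its
    initial value.\<close>
  have "ode_solution f U {0..1} (\<lambda>t. G (F x + 1 - \<sigma> * t))"
    by (rule ode_solution_G[OF assms]) (use True in auto)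
  from unit_time_map_inv_eq[OF this] show ?thesis
    using not_stable_from_right_if_pos True assms by (simp add: step_def G_F)
next
  case False
  then have \<sigma>: "\<sigma> = -1" using \<sigma> by linarith
  have "ode_solution f U {0..1} (\<lambda>t. G (F x - \<sigma> * t))"
    by (rule ode_solution_G[OF assms]) (use \<sigma> in auto)
  from unit_time_map_eq(1)[OF this] show ?thesis
    using stable_from_right_if_neg \<sigma> assms by (simp add: step_def G_F)
qed

lemma has_box_dim_orbit:
  fixes x :: "nat \<Rightarrow> real"
  assumes "0 < x 1" "x 1 < r" "\<forall>n\<ge>1. x (n + 1) = step (x n)"
  shows "has_box_dim (x ` {1..}) (1 - 1 / real (Suc k))"
proof -
  have G: "0 < x (Suc n)" "x (Suc n) < r" "F (x (Suc n)) = F (x n) + 1"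
    if "1 \<le> n" "0 < x n" "x n < r" for n
    using assms(3) that step_eq[OF that(2,3)] G_range[OF that(2,3), of "F (x n) + 1"] by auto
  have "0 < x n \<and> x n < r" if "1 \<le> n" for n
    using that by (induction n rule: dec_induct) (use assms G in auto)
  then show ?thesis using G by (intro has_box_dim_seq) auto
qed

end

text \<open>Once \<open>K * x \<le> \<bar>c\<bar> / 2\<close>, the remainder is at most half of the
  leading term, which then fixes both sign and size of \<open>f x\<close>.\<close>

lemma eventually_first_term_bounds:
  fixes f :: "real \<Rightarrow> real"
  assumes "c \<noteq> 0" and O: "(\<lambda>x. f x - c * x ^ m) \<in> O[at 0](\<lambda>x. \<bar>x\<bar> ^ (m + 1))"
  shows "\<forall>\<^sub>F x in at_right 0. f x = sgn c * \<bar>f x\<bar> \<and>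
    \<bar>c\<bar> / 2 * x ^ m \<le> \<bar>f x\<bar> \<and> \<bar>f x\<bar> \<le> 2 * \<bar>c\<bar> * x ^ m"
proof -
  obtain K where "0 < K" and K: "\<forall>\<^sub>F x in at 0. norm (f x - c * x ^ m) \<le> K * norm (\<bar>x\<bar> ^ (m + 1))"
    using O by (elim landau_o.bigE)
  have "\<forall>\<^sub>F x in at_right 0. norm (f x - c * x ^ m) \<le> K * norm (\<bar>x\<bar> ^ (m + 1))"
    using K by (rule filter_leD[rotated]) (simp add: at_le)
  moreover have "\<forall>\<^sub>F x in at_right 0. x \<in> {0<..<\<bar>c\<bar> / 2 / K}"
    using \<open>0 < K\<close> \<open>c \<noteq> 0\<close> by (intro eventually_at_right_real) auto
  ultimately show ?thesis
  proof eventually_elim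
    case (elim x)
    have xm: "0 < x ^ m" using elim by simp
    have "K * x \<le> \<bar>c\<bar> / 2" using elim \<open>0 < K\<close> by (simp add: field_simps)
    then have "K * x * x ^ m \<le> \<bar>c\<bar> / 2 * x ^ m" using xm by (intro mult_right_mono) auto
    moreover have "\<bar>f x - c * x ^ m\<bar> \<le> K * x * x ^ m" using elim by (simp add: abs_mult power_abs mult_ac)
    ultimately have "\<bar>f x - c * x ^ m\<bar> \<le> \<bar>c\<bar> * x ^ m / 2" by simp
    moreover have "0 < \<bar>c\<bar> * x ^ m" using xm \<open>c \<noteq> 0\<close> by simp
    ultimately show ?case by (cases "0 < c") (auto simp: sgn_if abs_if split: if_splits)
  qed
qed

theorem theorem12:
  fixes f :: "real \<Rightarrow> real" and U :: "real set" and m :: nat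
  assumes "m > 1"
    and "open U" and "0 \<in> U" and "C_on m U f"
    and "taylor_begins_with_degree f m"
    and "nonhyperbolic_singularity f 0"
  shows "\<exists>r1>0. \<forall>x1\<in>{0<..<r1}. \<forall>x :: nat \<Rightarrow> real.
           x 1 = x1 \<longrightarrow>
           (\<forall>n\<ge>1. x (n + 1) =
              (if stable_from_right f U 0 then unit_time_map f U (x n)
               else unit_time_map_inv f U (x n))) \<longrightarrow>
           has_box_dim (x ` {1..}) (1 - 1 / real m)"
proof -
  obtain k where m: "m = Suc k" and "0 < k" using \<open>m > 1\<close> by (cases m) auto
  have diff: "f field_differentiable at x" "deriv f field_differentiable at x" if "x \<in> U" for x
    using \<open>C_on m U f\<close> that \<open>m > 1\<close> unfolding C_on_def by (force dest: spec[of _ 0] spec[of _ 1])+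
  have C1: "C1_ode f U"
    using \<open>open U\<close> diff
    by unfold_locales (auto intro!: continuous_at_imp_continuous_on field_differentiable_imp_continuous_at)
  define c where "c = taylor_coeff f m"
  have c: "c \<noteq> 0" "(\<lambda>x. f x - c * x ^ m) \<in> O[at 0](\<lambda>x. \<bar>x\<bar> ^ (m + 1))"
    using assms(5) by (auto simp: taylor_begins_with_degree_def c_def)
  have "\<forall>\<^sub>F x in at_right 0. x \<in> U"
    using eventually_nhds_in_open[OF \<open>open U\<close> \<open>0 \<in> U\<close>] by (simp add: eventually_at_filter eventually_mono)
  with eventually_first_term_bounds[OF c]
  have "\<forall>\<^sub>F x in at_right 0. x \<in> U \<and> f x = sgn c * \<bar>f x\<bar> \<and>
    \<bar>c\<bar> / 2 * x ^ m \<le> \<bar>f x\<bar> \<and> \<bar>f x\<bar> \<le> 2 * \<bar>c\<bar> * x ^ m"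
    by eventually_elim simp
  then obtain r0 where "0 < r0" and "\<forall>x. 0 < x \<and> x < r0 \<longrightarrow> x \<in> U \<and> f x = sgn c * \<bar>f x\<bar> \<and>
    \<bar>c\<bar> / 2 * x ^ m \<le> \<bar>f x\<bar> \<and> \<bar>f x\<bar> \<le> 2 * \<bar>c\<bar> * x ^ m"
    unfolding eventually_at_right_field by blast
  then have r0: "x \<in> U" "f x = sgn c * \<bar>f x\<bar>" "\<bar>c\<bar> / 2 * x ^ m \<le> \<bar>f x\<bar>" "\<bar>f x\<bar> \<le> 2 * \<bar>c\<bar> * x ^ m"
    if "0 < x" "x < r0" for x
    using that by blast+
  \<comment> \<open>With \<open>r \<le> 1\<close> one has \<open>r ^ k \<le> r\<close>, and
    \<open>r \<le> 1 / (4 * \<bar>c\<bar>)\<close> then gives the smallness condition of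
    \<open>power_speed\<close> for \<open>b = 2 * \<bar>c\<bar>\<close>.\<close>
  define r where "r = min r0 (min 1 (1 / (4 * \<bar>c\<bar>)))"
  have r: "0 < r" "r \<le> r0" "r \<le> 1" "r \<le> 1 / (4 * \<bar>c\<bar>)" using \<open>0 < r0\<close> c by (auto simp: r_def)
  have "isCont (\<lambda>x. - 1 / \<bar>f x\<bar>) x" if "0 < x" "x < r" for x
  proof -
    have "0 < \<bar>c\<bar> / 2 * x ^ m" using c that by simp
    then have "f x \<noteq> 0" using r0(3)[of x] that r by force
    then show ?thesis
      using diff(1)[of x, THEN field_differentiable_imp_continuous_at] r0(1)[of x] \<open>f x \<noteq> 0\<close> that r
      by (intro continuous_intros) auto
  qed
  \<comment> \<open>The integrand blows up at 0, so the antiderivative is taken on the open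
    interval.\<close>
  then obtain F where F: "\<And>x. 0 < x \<Longrightarrow> x < r \<Longrightarrow> (F has_real_derivative - 1 / \<bar>f x\<bar>) (at x)"
    using einterval_antiderivative[of 0 r "\<lambda>x. - 1 / \<bar>f x\<bar>"] r
    by (auto simp: has_real_derivative_iff_has_vector_derivative zero_ereal_def)
  interpret C1_ode f U by (rule C1)
  interpret power_ode f U F k "\<bar>c\<bar> / 2" "2 * \<bar>c\<bar>" r "sgn c"
  proof unfold_locales
    have "2 * \<bar>c\<bar> * r ^ k \<le> 2 * \<bar>c\<bar> * r"
      using r \<open>0 < k\<close> power_decreasing[of 1 k r] by (intro mult_left_mono) auto
    also have "\<dots> \<le> 2 * \<bar>c\<bar> * (1 / (4 * \<bar>c\<bar>))" using r by (intro mult_left_mono) auto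
    finally show "2 * \<bar>c\<bar> * r ^ k \<le> 1 / 2" using c by simp
    show "{0<..<r} \<subseteq> U" using r0(1) r by auto
    show "f 0 = 0" using assms(6) by (simp add: nonhyperbolic_singularity_def)
    fix x assume x: "0 < x" "x < r"
    then have "x < r0" using r by simp
    with x show "\<bar>c\<bar> / 2 * x ^ Suc k \<le> \<bar>f x\<bar>" "\<bar>f x\<bar> \<le> 2 * \<bar>c\<bar> * x ^ Suc k" "f x = sgn c * \<bar>f x\<bar>"
      using r0(2-4) unfolding m by blast+
    show "(F has_real_derivative - 1 / \<bar>f x\<bar>) (at x)" using F x by simp
  qed (use c r \<open>0 < k\<close> \<open>0 \<in> U\<close> in \<open>auto simp: sgn_if\<close>)
  show ?thesis
    using r(1) has_box_dim_orbit unfolding step_def m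
    by (intro exI[of _ r] conjI ballI allI impI) auto
qed

end
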